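(* Let $\varphi$ denote Euler's totient function. For every positive rational number $r$ there exist positive integers $m$ and $n$ such that $$r=\frac{\varphi(m^2)}{\varphi(n^2)}.$$
   Context: Euler's totient function $\varphi$ is the standard one: for a positive integer $n$, $\varphi(n)$ is the number of integers in $\{1,\ldots,n\}$ coprime to $n$ (so $\varphi(1)=1$). *)

theory Defs
  imports "HOL-Number_Theory.Totient"
begin

end

theory Submission
  imports Defs
begin

text \<open>
  For a prime \<open>p\<close> not dividing \<open>m\<close> and \<open>s > 0\<close> we have
  \<open>\<phi>((p\<^sup>s m)\<^sup>2) = p\<^sup>2\<^sup>s\<^sup>-\<^sup>1 (p - 1) \<phi>(m\<^sup>2)\<close>, where \<open>p - 1\<close> only involves primes below \<open>p\<close>. Hence
  primes can be removed from \<open>a / b\<close> in descending order: if the exponent of \<open>p\<close> in \<open>a / b\<close> is odd,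
  put a power of \<open>p\<close> into only one of \<open>m\<close>, \<open>n\<close>; if it is even, put powers of \<open>p\<close> into both, so that
  the factors \<open>p - 1\<close> cancel.
\<close>

lemma totient_prime_power_mult_square:
  fixes p m s :: nat
  assumes "prime p" "\<not> p dvd m" "s > 0"
  shows "totient ((p ^ s * m) ^ 2) = p ^ (2 * s - 1) * (p - 1) * totient (m ^ 2)"
proof -
  have "coprime (p ^ (2 * s)) (m ^ 2)"
    using assms by (simp add: prime_imp_coprime)
  moreover have "(p ^ s * m) ^ 2 = p ^ (2 * s) * m ^ 2"
    by (simp add: power_mult_distrib power_mult [symmetric] mult.commute)
  ultimately show ?thesis
    using assms by (simp add: totient_mult_coprime totient_prime_power)
qed

text \<open>The equation \<open>a / b = totient (m ^ 2) / totient (n ^ 2)\<close> is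
  cross-multiplied to stay in \<open>nat\<close>. The bound \<open>N\<close> makes the induction
  work: if \<open>Suc N\<close> is prime, it divides neither \<open>m\<close> nor \<open>n\<close>,
  so its powers can be inserted freely.\<close>

definition totient_square_ratio :: "nat \<Rightarrow> nat \<Rightarrow> nat \<Rightarrow> bool" where
  "totient_square_ratio N a b \<longleftrightarrow> (\<exists>m n. m > 0 \<and> n > 0 \<and>
     (\<forall>q. prime q \<longrightarrow> q dvd m * n \<longrightarrow> q \<le> N) \<and>
     a * totient (n ^ 2) = b * totient (m ^ 2))"

lemma totient_square_ratio_sym:
  "totient_square_ratio N a b \<Longrightarrow> totient_square_ratio N b a"
  unfolding totient_square_ratio_def by (metis mult.commute)

lemma totient_square_ratio_mono:
  "totient_square_ratio N a b \<Longrightarrow> N \<le> M \<Longrightarrow> totient_square_ratio M a b"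
  unfolding totient_square_ratio_def by (meson le_trans)

lemma totient_square_ratio_mult_left:
  assumes "totient_square_ratio N a b"
  shows "totient_square_ratio N (c * a) (c * b)"
  using assms unfolding totient_square_ratio_def by (auto simp: mult.assoc)

text \<open>Multiplying \<open>m\<close> by \<open>p ^ (k + 1)\<close> and \<open>n\<close> by
  \<open>p\<close> contributes \<open>p ^ (2 * k + 1) * (p - 1)\<close> and
  \<open>p * (p - 1)\<close> respectively, with quotient \<open>p ^ (2 * k)\<close>.\<close>

lemma totient_square_ratio_even_step:
  assumes p: "prime (Suc N)" and ab: "totient_square_ratio N a b"
  shows "totient_square_ratio (Suc N) (Suc N ^ (2 * k) * a) b"
proof -
  let ?p = "Suc N"
  obtain m n where mn: "m > 0" "n > 0" "\<And>q. prime q \<Longrightarrow> q dvd m * n \<Longrightarrow> q \<le> N"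
    "a * totient (n ^ 2) = b * totient (m ^ 2)"
    using ab unfolding totient_square_ratio_def by blast
  have nd: "\<not> ?p dvd m" "\<not> ?p dvd n"
    using mn(3)[OF p] by auto
  let ?m = "?p ^ Suc k * m" and ?n = "?p ^ 1 * n"
  have "(?p ^ (2 * k) * a) * totient (?n ^ 2) = ?p ^ (2 * k + 1) * (?p - 1) * (a * totient (n ^ 2))"
    by (subst totient_prime_power_mult_square[OF p nd(2)]) (simp_all add: algebra_simps)
  also have "\<dots> = b * totient (?m ^ 2)"
    by (subst totient_prime_power_mult_square[OF p nd(1)]) (simp_all add: mn(4) algebra_simps)
  finally have "(?p ^ (2 * k) * a) * totient (?n ^ 2) = b * totient (?m ^ 2)" .
  moreover have "q \<le> ?p" if "prime q" "q dvd ?m * ?n" for q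
  proof -
    have "q dvd ?p \<or> q dvd m * n"
      using that by (meson prime_dvd_mult_iff prime_dvd_power)
    then show ?thesis
      using mn(3)[OF that(1)] by (auto dest: dvd_imp_le)
  qed
  moreover have "?m > 0" "?n > 0" using mn by auto
  ultimately show ?thesis
    unfolding totient_square_ratio_def by blast
qed

text \<open>Only \<open>m\<close> receives a power of \<open>p\<close>, so the factor
  \<open>p - 1 = N\<close> survives. The \<open>N * b\<close> in the hypothesis compensates for it
  in advance.\<close>

lemma totient_square_ratio_odd_step:
  assumes p: "prime (Suc N)" and ab: "totient_square_ratio N a (N * b)"
  shows "totient_square_ratio (Suc N) (Suc N ^ (2 * k + 1) * a) b"
proof -
  let ?p = "Suc N"
  obtain m n where mn: "m > 0" "n > 0" "\<And>q. prime q \<Longrightarrow> q dvd m * n \<Longrightarrow> q \<le> N"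
    "a * totient (n ^ 2) = N * b * totient (m ^ 2)"
    using ab unfolding totient_square_ratio_def by blast
  have nd: "\<not> ?p dvd m"
    using mn(3)[OF p] by auto
  let ?m = "?p ^ Suc k * m"
  have "(?p ^ (2 * k + 1) * a) * totient (n ^ 2) = ?p ^ (2 * k + 1) * (a * totient (n ^ 2))"
    by (simp only: mult.assoc)
  also have "\<dots> = b * totient (?m ^ 2)"
    by (subst totient_prime_power_mult_square[OF p nd]) (simp_all add: mn(4) algebra_simps)
  finally have "(?p ^ (2 * k + 1) * a) * totient (n ^ 2) = b * totient (?m ^ 2)" .
  moreover have "q \<le> ?p" if "prime q" "q dvd ?m * n" for q
  proof -
    have "q dvd ?p \<or> q dvd m * n"
      using that by (meson prime_dvd_mult_iff prime_dvd_power)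
    then show ?thesis
      using mn(3)[OF that(1)] by (auto dest: dvd_imp_le)
  qed
  moreover have "?m > 0" using mn by auto
  ultimately show ?thesis
    using mn(2) unfolding totient_square_ratio_def by blast
qed

text \<open>Induction on the prime bound. The pair \<open>a\<close>, \<open>b\<close> must vary
  because the odd step passes from \<open>b\<close> to \<open>N * b\<close>; this adds only prime
  factors of \<open>N\<close>, which respect the smaller bound.\<close>

lemma totient_square_ratio_smooth:
  assumes "a > 0" "b > 0" "\<And>q. prime q \<Longrightarrow> q dvd a * b \<Longrightarrow> q \<le> N"
  shows "totient_square_ratio N a b"
  using assms
proof (induction N arbitrary: a b)
  case 0
  \<comment> \<open>No prime is at most 0, so \<open>a * b\<close> has no prime factor.\<close>
  have "a * b = 1"
    using 0(3) by (metis prime_factor_nat not_prime_0 le_zero_eq)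
  then show ?case
    unfolding totient_square_ratio_def by (intro exI[of _ 1]) auto
next
  case (Suc N)
  let ?p = "Suc N"
  show ?case
  proof (cases "prime ?p")
    case False
    have "totient_square_ratio N a b"
      using Suc.prems False by (intro Suc.IH) (auto simp: le_Suc_eq)
    then show ?thesis
      by (rule totient_square_ratio_mono) simp
  next
    case p: True
    have "N > 0" using p by (cases N) auto
    \<comment> \<open>The exponent \<open>e\<close> of \<open>p\<close> in \<open>a / b\<close> may be taken nonnegative, by symmetry.\<close>
    have step: "totient_square_ratio ?p (?p ^ e * a) b"
      if pos: "a > 0" "b > 0" and nd: "\<not> ?p dvd a" "\<not> ?p dvd b"
        and le: "\<And>q. prime q \<Longrightarrow> q dvd a * b \<Longrightarrow> q \<le> ?p" for a b e
    proof -
      \<comment> \<open>The extra factor \<open>N\<close> lets this one bound serve both parities of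
        \<open>e\<close>.\<close>
      have small: "q \<le> N" if q: "prime q" "q dvd N * (a * b)" for q
      proof (cases "q dvd N")
        case True
        then show ?thesis using \<open>N > 0\<close> by (rule dvd_imp_le)
      next
        case False
        then have "q dvd a * b" using q by (simp add: prime_dvd_mult_iff)
        moreover from this have "q \<noteq> ?p"
          using p nd by (auto simp: prime_dvd_mult_iff)
        ultimately show ?thesis using le[of q] q by simp
      qed
      show ?thesis
      proof (cases "even e")
        case True
        then obtain k where "e = 2 * k" by (rule evenE)
        moreover have "totient_square_ratio N a b"
          using pos small by (intro Suc.IH) auto
        ultimately show ?thesis
          using totient_square_ratio_even_step[OF p] by blast
      next
        case False
        then obtain k where "e = 2 * k + 1" by (rule oddE)
        moreover have "totient_square_ratio N a (N * b)"
          using pos small \<open>N > 0\<close> by (intro Suc.IH) (auto simp: mult.left_commute)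
        ultimately show ?thesis
          using totient_square_ratio_odd_step[OF p] by blast
      qed
    qed
    obtain i a' where a: "a = ?p ^ i * a'" "\<not> ?p dvd a'"
      using Suc.prems(1) p by (metis multiplicity_decompose' not_prime_unit neq0_conv)
    obtain j b' where b: "b = ?p ^ j * b'" "\<not> ?p dvd b'"
      using Suc.prems(2) p by (metis multiplicity_decompose' not_prime_unit neq0_conv)
    have pos: "a' > 0" "b' > 0" using Suc.prems a b by auto
    have small: "q \<le> ?p" if "prime q" "q dvd a' * b'" for q
      using that Suc.prems(3)[of q] unfolding a b by (auto simp: prime_dvd_mult_iff)
    show ?thesis
    proof (cases "j \<le> i")
      case True
      \<comment> \<open>The common factor \<open>p ^ j\<close> is split off, leaving the exponent
        \<open>i - j\<close> on one side only.\<close>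
      have "totient_square_ratio ?p (?p ^ j * (?p ^ (i - j) * a')) (?p ^ j * b')"
        using pos a b small by (intro totient_square_ratio_mult_left step) auto
      then show ?thesis
        using True by (simp add: a b mult.assoc [symmetric] power_add [symmetric] del: power_Suc)
    next
      case False
      have "totient_square_ratio ?p (?p ^ i * (?p ^ (j - i) * b')) (?p ^ i * a')"
        using pos a b small by (intro totient_square_ratio_mult_left step) (auto simp: mult.commute)
      then show ?thesis
        using False by (intro totient_square_ratio_sym[of _ b])
          (simp add: a b mult.assoc [symmetric] power_add [symmetric] del: power_Suc)
    qed
  qed
qed

theorem theorem1:
  fixes r :: rat
  assumes "r > 0"
  shows "\<exists>m n :: nat. m > 0 \<and> n > 0 \<and> r = of_nat (totient (m ^ 2)) / of_nat (totient (n ^ 2))"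
proof -
  obtain x y :: int where xy: "r = of_int x / of_int y" "y > 0"
    by (metis quotient_of_div quotient_of_denom_pos surj_pair)
  have "x > 0" using assms xy by (simp add: zero_less_divide_iff)
  define a b where "a = nat x" and "b = nat y"
  have ab: "a > 0" "b > 0" "r = of_nat a / of_nat b"
    using xy \<open>x > 0\<close> by (simp_all add: a_def b_def)
  \<comment> \<open>The product \<open>a * b\<close> itself bounds all of its prime
    divisors.\<close>
  have "totient_square_ratio (a * b) a b"
    using ab by (intro totient_square_ratio_smooth) (auto intro: dvd_imp_le)
  then obtain m n where mn: "m > 0" "n > 0" "a * totient (n ^ 2) = b * totient (m ^ 2)"
    unfolding totient_square_ratio_def by blast
  have "(of_nat a * of_nat (totient (n ^ 2)) :: rat) = of_nat b * of_nat (totient (m ^ 2))"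
    using mn(3) by (metis of_nat_mult)
  then have "r = of_nat (totient (m ^ 2)) / of_nat (totient (n ^ 2))"
    using ab(2) mn(2) unfolding ab(3) by (subst frac_eq_eq) (simp_all add: mult.commute)
  with mn show ?thesis by blast
qed

end
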